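(* Let $\Sigma$ be an alphabet and let $L \subseteq \Sigma^*$ be a finite language over $\Sigma$ (that is, $L$ is a finite set of words). Then there exists a Turing machine $M$ with input alphabet $\Sigma$ such that $M$ accepts the language $L$ and, in addition, for every natural number $k$ and every word $w \in \Sigma^*$ of length $k$, the machine $M$ started on input $w$ stops in at most $k+1$ steps.
   Context: An alphabet is a finite set of symbols, and $\Sigma^*$ denotes the set of all finite words over $\Sigma$, including the empty word. The length of a word is its number of letters. Turing machines are deterministic and single-tape. A Turing machine is a tuple $M = (\Sigma, \Gamma, Q, \delta)$, where $\Sigma$ is the finite input alphabet; $\Gamma$ is the finite tape alphabet, with $\Sigma \subseteq \Gamma$ and a blank symbol $b \in \Gamma \setminus \Sigma$; $Q$ is a finite set of states containing three distinguished, pairwise distinct states $q_{start}, q_{accept}, q_{reject}$; and the transition function is $\delta : (Q \setminus \{q_{accept}, q_{reject}\}) \times \Gamma \to Q \times \Gamma \times \{-1, 1\}$. Here $\delta(q,s) = (q', s', d)$ means that in state $q$, reading symbol $s$, the machine writes $s'$ in the scanned cell, moves the head by one cell (right if $d = 1$, left if $d = -1$) and enters state $q'$. One application of $\delta$ is one step. The tape is a two-way infinite sequence of cells. On input $w \in \Sigma^*$, the machine starts in state $q_{start}$, with $w$ written on consecutive cells, all other cells containing $b$, and the head on the first symbol of $w$ (on a blank cell if $w$ is empty). The machine stops when it enters $q_{accept}$ or $q_{reject}$. It accepts $w$ if it stops in state $q_{accept}$. The machine $M$ accepts the language $L$ if $L$ is exactly the set of words $w \in \Sigma^*$ that $M$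 accepts. *)

theory Defs
  imports "HOL-Library.FuncSet"
begin

text \<open>
  Tape symbols have type \<open>'a + 'g\<close>: the input symbol \<open>a\<close> appears on the tape as \<open>Inl a\<close>, and the
  summand \<open>'g\<close> supplies further symbols (among them possibly the blank). Hence \<open>\<Sigma> \<subseteq> \<Gamma>\<close> reads
  \<open>Inl ` \<Sigma> \<subseteq> \<Gamma>\<close>, and there is room for a blank even if \<open>\<Sigma>\<close> exhausts the type \<open>'a\<close>.
\<close>

record ('a, 'g, 'q) tm =
  input_alphabet :: "'a set"
  tape_alphabet :: "('a + 'g) set"
  blank :: "'a + 'g"
  states :: "'q set"
  q_start :: 'q
  q_accept :: 'q
  q_reject :: 'q
  transition :: "'q \<times> ('a + 'g) \<Rightarrow> 'q \<times> ('a + 'g) \<times> int"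

text \<open>
  The transition function is constrained only on its domain; its values elsewhere are never used
  by a run of the machine.
\<close>

definition turing_machine :: "('a, 'g, 'q) tm \<Rightarrow> bool" where
  "turing_machine M \<longleftrightarrow>
     finite (input_alphabet M) \<and> finite (tape_alphabet M) \<and> finite (states M) \<and>
     Inl ` input_alphabet M \<subseteq> tape_alphabet M \<and>
     blank M \<in> tape_alphabet M - Inl ` input_alphabet M \<and>
     {q_start M, q_accept M, q_reject M} \<subseteq> states M \<and>
     distinct [q_start M, q_accept M, q_reject M] \<and>
     transition M \<in> (states M - {q_accept M, q_reject M}) \<times> tape_alphabet M
                      \<rightarrow> states M \<times> tape_alphabet M \<times> {-1, 1}"

text \<open>A configuration consists of the state, the tape contents and the head position.\<close>

type_synonym ('a, 'g, 'q) config = "'q \<times> (int \<Rightarrow> 'a + 'g) \<times> int"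

definition initial_config :: "('a, 'g, 'q) tm \<Rightarrow> 'a list \<Rightarrow> ('a, 'g, 'q) config" where
  "initial_config M w =
     (q_start M,
      (\<lambda>i. if 0 \<le> i \<and> i < int (length w) then Inl (w ! nat i) else blank M),
      0)"

definition halted :: "('a, 'g, 'q) tm \<Rightarrow> ('a, 'g, 'q) config \<Rightarrow> bool" where
  "halted M c \<longleftrightarrow> fst c \<in> {q_accept M, q_reject M}"

text \<open>A stopped machine makes no further step: halted configurations are left unchanged.\<close>

definition step :: "('a, 'g, 'q) tm \<Rightarrow> ('a, 'g, 'q) config \<Rightarrow> ('a, 'g, 'q) config" where
  "step M c =
     (if halted M c then c
      else case c of (q, t, h) \<Rightarrow>
        case transition M (q, t h) of (q', s', d) \<Rightarrow> (q', t(h := s'), h + d))"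

definition config_after :: "('a, 'g, 'q) tm \<Rightarrow> 'a list \<Rightarrow> nat \<Rightarrow> ('a, 'g, 'q) config" where
  "config_after M w n = (step M ^^ n) (initial_config M w)"

definition stops_within :: "('a, 'g, 'q) tm \<Rightarrow> 'a list \<Rightarrow> nat \<Rightarrow> bool" where
  "stops_within M w t \<longleftrightarrow> (\<exists>n\<le>t. halted M (config_after M w n))"

definition accepts :: "('a, 'g, 'q) tm \<Rightarrow> 'a list \<Rightarrow> bool" where
  "accepts M w \<longleftrightarrow> (\<exists>n. fst (config_after M w n) = q_accept M)"

definition accepts_language :: "('a, 'g, 'q) tm \<Rightarrow> 'a list set \<Rightarrow> bool" where
  "accepts_language M L \<longleftrightarrow> L = {w \<in> lists (input_alphabet M). accepts M w}"

end

theory Submission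
  imports Defs
begin

text \<open>
  The machine reads its input from left to right and keeps the prefix read so far in its state, as
  long as this prefix is short enough to belong to a fixed finite prefix-closed set \<open>P \<supseteq> L\<close>;
  otherwise it rejects. At the first blank it has moved once per letter and decides whether the
  stored word belongs to \<open>L\<close>.
\<close>

lemma halted_config_after_mono:
  assumes "halted M (config_after M w m)" and "m \<le> n"
  shows "config_after M w n = config_after M w m"
  using \<open>m \<le> n\<close>
proof (induction rule: dec_induct)
  case base
  show ?case ..
next
  case (step n)
  then show ?case
    using assms(1) by (simp add: config_after_def step_def)
qed

text \<open>Halted configurations are fixed by \<open>step\<close>, so any two halting times yield
  the same configuration and a single one decides acceptance.\<close>

lemma accepts_iff_halted_state:
  assumes "halted M (config_after M w m)"
  shows "accepts M w \<longleftrightarrow> fst (config_after M w m) = q_accept M"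
proof
  assume "accepts M w"
  then obtain n where n: "fst (config_after M w n) = q_accept M"
    by (auto simp: accepts_def)
  then have "halted M (config_after M w n)"
    by (simp add: halted_def)
  then have "config_after M w n = config_after M w m"
    using assms halted_config_after_mono by (metis nat_le_linear)
  then show "fst (config_after M w m) = q_accept M"
    using n by simp
qed (auto simp: accepts_def)

text \<open>The numbering \<open>e\<close> lets states be natural numbers. Prefix closure means that
  a run whose prefix has left \<open>P\<close> can never return to it, so rejecting at once is
  safe.\<close>

locale prefix_recognizer =
  fixes \<Sigma> :: "'a set" and L P :: "'a list set" and e :: "'a list \<Rightarrow> nat"
  assumes finite_alphabet: "finite \<Sigma>" and finite_prefixes: "finite P"
    and inj_e: "inj_on e P"
    and Nil_in_P: "[] \<in> P" and L_subset_P: "L \<subseteq> P"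
    and prefix_closed: "\<And>u a. u @ [a] \<in> P \<Longrightarrow> u \<in> P"
begin

text \<open>State 0 accepts, state 1 rejects; all words outside \<open>P\<close> share the rejecting state.\<close>

definition encode :: "'a list \<Rightarrow> nat" where
  "encode u = (if u \<in> P then e u + 2 else 1)"

text \<open>A left inverse of \<open>encode\<close> on \<open>P\<close>; its values at the halting
  states 0 and 1 never influence a run.\<close>

definition decode :: "nat \<Rightarrow> 'a list" where
  "decode q = inv_into P e (q - 2)"

definition next_state :: "'a list \<Rightarrow> 'a + nat \<Rightarrow> nat" where
  "next_state u s =
     (case s of Inl a \<Rightarrow> encode (u @ [a]) | Inr _ \<Rightarrow> if u \<in> L then 0 else 1)"

definition machine :: "('a, nat, nat) tm" where
  "machine =
     \<lparr>input_alphabet = \<Sigma>, tape_alphabet = insert (Inr 0) (Inl ` \<Sigma>), blank = Inr 0,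
      states = {0, 1} \<union> encode ` P, q_start = encode [], q_accept = 0, q_reject = 1,
      transition = (\<lambda>(q, s). (next_state (decode q) s, s, 1))\<rparr>"

lemma machine_simps [simp]:
  "input_alphabet machine = \<Sigma>" "tape_alphabet machine = insert (Inr 0) (Inl ` \<Sigma>)"
  "blank machine = Inr 0" "states machine = {0, 1} \<union> encode ` P"
  "q_start machine = encode []" "q_accept machine = 0" "q_reject machine = 1"
  "transition machine (q, s) = (next_state (decode q) s, s, 1)"
  by (simp_all add: machine_def)

lemma decode_encode: "u \<in> P \<Longrightarrow> decode (encode u) = u"
  by (simp add: decode_def encode_def inj_e)

lemma next_state_in_states: "next_state u s \<in> states machine"
  by (auto simp: next_state_def encode_def split: sum.split)

lemma turing_machine_machine: "turing_machine machine"
proof -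
  have "transition machine \<in> (states machine - {q_accept machine, q_reject machine}) \<times>
      tape_alphabet machine \<rightarrow> states machine \<times> tape_alphabet machine \<times> {-1, 1}"
    using next_state_in_states by (force simp del: machine_simps(4))
  moreover have "distinct [q_start machine, q_accept machine, q_reject machine]"
    using Nil_in_P by (simp add: encode_def)
  ultimately show ?thesis
    using finite_alphabet finite_prefixes Nil_in_P by (auto simp: turing_machine_def)
qed

text \<open>For \<open>u\<close> in \<open>P\<close> the code is at least 2, hence not halting, and
  the machine writes back the symbol it reads, so the tape is unchanged.\<close>

lemma step_encode:
  assumes "u \<in> P"
  shows "step machine (encode u, t, h) = (next_state u (t h), t, h + 1)"
  using assms by (simp add: step_def halted_def decode_encode) (simp add: encode_def)

text \<open>The state is tracked for every prefix, but tape and head only inside \<open>P\<close>: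
  once the prefix leaves \<open>P\<close>, the machine has halted and its head no longer
  moves.\<close>

lemma config_after_prefix:
  assumes "n \<le> length w"
  shows "fst (config_after machine w n) = encode (take n w) \<and>
    (take n w \<in> P \<longrightarrow> snd (config_after machine w n) = (fst (snd (initial_config machine w)), int n))"
  using assms
proof (induction n)
  case 0
  show ?case
    by (simp add: config_after_def initial_config_def)
next
  case (Suc n)
  then have take: "take (Suc n) w = take n w @ [w ! n]"
    by (simp add: take_Suc_conv_app_nth)
  have run: "config_after machine w (Suc n) = step machine (config_after machine w n)"
    by (simp add: config_after_def)
  show ?case
  proof (cases "take n w \<in> P")
    case True
    with Suc have "config_after machine w n =
        (encode (take n w), fst (snd (initial_config machine w)), int n)"
      by (simp add: prod_eq_iff)
    with True Suc.prems show ?thesis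
      by (simp add: run take step_encode next_state_def initial_config_def)
  next
    case False
    \<comment> \<open>The machine rests in state 1, which is also the code of the longer prefix,
      again outside \<open>P\<close>.\<close>
    moreover from this have "take (Suc n) w \<notin> P"
      using prefix_closed take by metis
    ultimately show ?thesis
      using Suc by (simp add: run step_def halted_def encode_def)
  qed
qed

lemma final_state:
  "fst (config_after machine w (length w + 1)) = (if w \<in> L then 0 else 1)"
proof -
  have run: "config_after machine w (Suc (length w)) =
      step machine (config_after machine w (length w))"
    by (simp add: config_after_def)
  show ?thesis
  proof (cases "w \<in> P")
    case True
    with config_after_prefix[of "length w" w] have "config_after machine w (length w) =
        (encode w, fst (snd (initial_config machine w)), int (length w))"
      by (simp add: prod_eq_iff)
    \<comment> \<open>The head is on cell \<open>length w\<close>, the first blank after the input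
      (cell 0 if \<open>w\<close> is empty), so this one extra step tests membership in
      \<open>L\<close>.\<close>
    with True show ?thesis
      by (simp add: run step_encode next_state_def initial_config_def)
  next
    case False
    with config_after_prefix[of "length w" w] L_subset_P show ?thesis
      by (auto simp: run step_def halted_def encode_def)
  qed
qed

lemma halted_final: "halted machine (config_after machine w (length w + 1))"
  unfolding halted_def final_state by simp

lemma stops_within_machine: "stops_within machine w (length w + 1)"
  unfolding stops_within_def using halted_final by blast

lemma accepts_machine_iff: "accepts machine w \<longleftrightarrow> w \<in> L"
  unfolding accepts_iff_halted_state[OF halted_final] final_state by simp

end

theorem proposition1:
  fixes \<Sigma> :: "'a set" and L :: "'a list set"
  assumes "finite \<Sigma>" and "L \<subseteq> lists \<Sigma>" and "finite L"
  shows "\<exists>M :: ('a, nat, nat) tm.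
    turing_machine M \<and> input_alphabet M = \<Sigma> \<and> accepts_language M L \<and>
    (\<forall>k. \<forall>w \<in> lists \<Sigma>. length w = k \<longrightarrow> stops_within M w (k + 1))"
proof -
  obtain N where N: "\<forall>w\<in>L. length w \<le> N"
    using \<open>finite L\<close> by (metis finite_imageI finite_nat_set_iff_bounded_le imageI)
  \<comment> \<open>Bounding the length alone gives a prefix-closed set, finite because \<Sigma> is
    finite; it contains \<open>[]\<close> even if \<open>L\<close> is empty.\<close>
  define P where "P = {u. set u \<subseteq> \<Sigma> \<and> length u \<le> N}"
  have "finite P"
    unfolding P_def using \<open>finite \<Sigma>\<close> by (rule finite_lists_length_le)
  then obtain e :: "'a list \<Rightarrow> nat" where "inj_on e P"
    using finite_imp_inj_to_nat_seg by blast
  interpret prefix_recognizer \<Sigma> L P e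
    using \<open>finite \<Sigma>\<close> \<open>finite P\<close> \<open>inj_on e P\<close> \<open>L \<subseteq> lists \<Sigma>\<close> N
    by unfold_locales (auto simp: P_def)
  have "accepts_language machine L"
    using \<open>L \<subseteq> lists \<Sigma>\<close> by (auto simp: accepts_language_def accepts_machine_iff)
  then show ?thesis
    using turing_machine_machine stops_within_machine
    by (intro exI[of _ machine]) auto
qed

end
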